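(* Let $\tilde\eta,\tilde\nu,\tilde\tau$ be non-negative functions, analytic in a neighborhood of $0$, and for $q\geq 0$ small put $\eta=\tilde\eta(\sqrt q)$, $\nu=\tilde\nu(\sqrt q)$, $\tau=\tilde\tau(\sqrt q)$, $\zeta=1+(1-\tau)\sqrt q$, and $$\mathbf I=\zeta\nu(\tau+\zeta\eta\sqrt q)-\tau^2,\qquad\mathbf{II}=\tau(\nu\tau-2\zeta\eta)+\zeta\eta(\nu\tau-\zeta\eta)\sqrt q.$$ Denote the Taylor expansions of $\mathbf I$ and $\mathbf{II}$ in $\sqrt q$ by $\mathbf I=\sum_{n\ge0}a_n(\sqrt q)^n$ and $\mathbf{II}=\sum_{m\ge0}b_m(\sqrt q)^m$. When $\mathbf I$ is not identically $0$, let $N$ be the minimal $n$ with $a_n\ne0$; when $\mathbf{II}$ is not identically $0$, let $M$ be the minimal $m$ with $b_m\ne0$. Then: (ia) If $a_N>0$, $b_M<0$ and $M\le N-2$, then $\mathbf I>0$ and $\mathbf I+\sqrt q\,\mathbf{II}\le0$ for $0<q\lesssim\mu/L$. (ib) If $a_N>0$, $b_M<0$, $M=N-1$, and the first nonzero element of $\{a_n+b_{n-1}\}_{n\ge N}$ is negative or this entire sequence is $0$, then $\mathbf I>0$ and $\mathbf I+\sqrt q\,\mathbf{II}\le0$ for $0<q\lesssim\mu/L$. (iia) If $a_N<0$, $b_M>0$ and $M=N$, then $\mathbf{II}>0$ and $\frac\mu L\mathbf I+\sqrt q\,\mathbf{II}\le0$ for $0<q\lesssim\mu^2/L^2$. (iib)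 If $a_N<0$, $b_M>0$ and $M\ge N+1$, then $\mathbf{II}>0$ and $\frac\mu L\mathbf I+\sqrt q\,\mathbf{II}\le0$ for $0<q\lesssim\mu/L$. (iii) If $a_N<0$ (or $N$ does not exist) and $b_M<0$ (or $M$ does not exist), then $\mathbf I\le0$ and $\mathbf{II}\le0$ for $0<q\lesssim\mu/L$.
   Context: Here $0<\mu\le L$ are arbitrary. A statement "holds for $0<q\lesssim\mu/L$" (respectively $0<q\lesssim\mu^2/L^2$) means: there is a constant $C_0>0$, depending only on $(\tilde\eta,\tilde\nu,\tilde\tau)$, such that it holds for all $0<\mu\le L$ and all $0<q\le C_0\mu/L$ (respectively $0<q\le C_0\mu^2/L^2$). In (ia)–(iib), the hypotheses include that $N$ and $M$ exist. *)

theory Defs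
  imports "HOL-Analysis.Analysis"
begin

(* The library's analytic_on is restricted to functions complex => complex. *)
definition real_analytic_at :: "(real \<Rightarrow> real) \<Rightarrow> real \<Rightarrow> bool" where
  "real_analytic_at f x \<longleftrightarrow> (\<exists>F. (\<lambda>h. f (x + h)) has_fps_expansion F)"

definition taylor_coeff :: "(real \<Rightarrow> real) \<Rightarrow> nat \<Rightarrow> real" where
  "taylor_coeff f n = (deriv ^^ n) f 0 / fact n"

(* zeta, I and II as functions of the variable s = sqrt q; for s < 0 the same
   formulas extend them to a neighbourhood of 0, on which the Taylor
   coefficients are taken. *)
definition zeta_fun :: "(real \<Rightarrow> real) \<Rightarrow> real \<Rightarrow> real" where
  "zeta_fun \<tau> s = 1 + (1 - \<tau> s) * s"

definition I_fun :: "(real \<Rightarrow> real) \<Rightarrow> (real \<Rightarrow> real) \<Rightarrow> (real \<Rightarrow> real) \<Rightarrow> real \<Rightarrow> real" where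
  "I_fun \<eta> \<nu> \<tau> s =
     zeta_fun \<tau> s * \<nu> s * (\<tau> s + zeta_fun \<tau> s * \<eta> s * s) - (\<tau> s)\<^sup>2"

definition II_fun :: "(real \<Rightarrow> real) \<Rightarrow> (real \<Rightarrow> real) \<Rightarrow> (real \<Rightarrow> real) \<Rightarrow> real \<Rightarrow> real" where
  "II_fun \<eta> \<nu> \<tau> s =
     \<tau> s * (\<nu> s * \<tau> s - 2 * zeta_fun \<tau> s * \<eta> s)
     + zeta_fun \<tau> s * \<eta> s * (\<nu> s * \<tau> s - zeta_fun \<tau> s * \<eta> s) * s"

(* Only meaningful if some c n is nonzero. *)
definition first_nonzero :: "(nat \<Rightarrow> real) \<Rightarrow> nat" where
  "first_nonzero c = (LEAST n. c n \<noteq> 0)"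

end

theory Submission
  imports Defs
begin

text \<open>
  Close to \<open>0\<close> from the right, an analytic function has the sign of its first nonzero Taylor
  coefficient. In (i) and (iii) this is applied to \<open>I\<close>, \<open>II\<close> and \<open>I + s II\<close> with \<open>s = sqrt q\<close>.
  In (iia) the condition on \<open>q\<close> gives \<open>s \<le> K \<mu> / L\<close>, so that
  \<open>\<mu> / L * I + s II \<le> \<mu> / L * (I + K II)\<close>; for \<open>K\<close> small, the leading coefficient
  \<open>a\<^sub>N + K b\<^sub>N\<close> of the bracket is negative. In (iib) it gives \<open>s\<^sup>2 \<le> K \<mu> / L\<close>, and the
  same argument works for \<open>s I + K II\<close>.
\<close>

section \<open>Taylor coefficients and signs to the right of 0\<close>

lemma taylor_coeff_eq_fps_nth:
  assumes "f has_fps_expansion F"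
  shows "taylor_coeff f n = fps_nth F n"
proof -
  \<comment> \<open>Differentiation matches formal differentiation, and the constant term of the
    n-th formal derivative is \<open>fact n\<close> times the n-th coefficient.\<close>
  have "(deriv ^^ n) f has_fps_expansion (fps_deriv ^^ n) F"
    by (induction n) (auto intro: assms has_fps_expansion_deriv)
  then have "(deriv ^^ n) f 0 = fps_nth ((fps_deriv ^^ n) F) 0"
    by (auto simp: has_fps_expansion_def eval_fps_at_0 dest: eventually_nhds_x_imp_x)
  then show ?thesis
    by (simp add: taylor_coeff_def fps_0th_higher_deriv)
qed

text \<open>Dividing by \<open>s ^ n\<close> leaves a function that extends continuously to 0 with
  the nonzero value \<open>fps_nth F n\<close>. The factor \<open>s ^ n\<close> is positive for s >
  0, so it does not affect the sign on that side.\<close>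

lemma has_fps_expansion_imp_eventually_sgn:
  fixes f :: "real \<Rightarrow> real"
  assumes f: "f has_fps_expansion F"
    and below: "\<And>k. k < n \<Longrightarrow> fps_nth F k = 0"
    and nz: "fps_nth F n \<noteq> 0"
  shows "\<forall>\<^sub>F s in at_right 0. sgn (f s) = sgn (fps_nth F n)"
proof -
  let ?c = "fps_nth F n"
  define g where "g = (\<lambda>x. if x = 0 then ?c else f x / x ^ n)"
  have "subdegree F = n"
    using nz below by (intro subdegreeI)
  then have "g has_fps_expansion fps_shift n F"
    unfolding g_def using f by (intro has_fps_expansion_shift) auto
  then have "(g \<longlongrightarrow> ?c) (at_right 0)"
    using has_fps_expansion_imp_continuous[of g "fps_shift n F" "{0<..}"]
    by (auto simp: continuous_within g_def)
  \<comment> \<open>Multiplying by the limit itself treats both signs at once: the new limit is a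
    positive square.\<close>
  then have "((\<lambda>s. ?c * g s) \<longlongrightarrow> ?c * ?c) (at_right 0)"
    by (intro tendsto_intros)
  moreover have "?c * ?c > 0"
    using nz by (auto simp: zero_less_mult_iff linorder_neq_iff)
  ultimately have "\<forall>\<^sub>F s in at_right 0. ?c * g s > 0"
    by (rule order_tendstoD(1))
  moreover have "\<forall>\<^sub>F s::real in at_right 0. s > 0"
    by (simp add: eventually_at_right_less)
  ultimately show ?thesis
    by eventually_elim (auto simp: g_def zero_less_mult_iff zero_less_divide_iff divide_less_0_iff)
qed

lemma has_fps_expansion_imp_eventually_pos:
  fixes f :: "real \<Rightarrow> real"
  assumes "f has_fps_expansion F" "\<And>k. k < n \<Longrightarrow> fps_nth F k = 0" "fps_nth F n > 0"
  shows "\<forall>\<^sub>F s in at_right 0. f s > 0"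
  using has_fps_expansion_imp_eventually_sgn[of f F n, OF assms(1,2)] assms(3)
  by (auto simp: sgn_1_pos)

lemma has_fps_expansion_imp_eventually_neg:
  fixes f :: "real \<Rightarrow> real"
  assumes "f has_fps_expansion F" "\<And>k. k < n \<Longrightarrow> fps_nth F k = 0" "fps_nth F n < 0"
  shows "\<forall>\<^sub>F s in at_right 0. f s < 0"
  using has_fps_expansion_imp_eventually_sgn[of f F n, OF assms(1,2)] assms(3)
  by (auto simp: sgn_1_neg)

lemma has_fps_expansion_0_imp_eventually_0:
  fixes f :: "real \<Rightarrow> real"
  assumes "f has_fps_expansion 0"
  shows "\<forall>\<^sub>F s in at_right 0. f s = 0"
  using assms
  by (auto simp: has_fps_expansion_def intro: eventually_at_filter[THEN iffD2] elim: eventually_mono)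

section \<open>From small s to ranges of q uniform in \<mu> and L\<close>

lemma eventually_at_right_0_imp_sqrt:
  fixes P :: "real \<Rightarrow> bool"
  assumes "\<forall>\<^sub>F s in at_right 0. P s" "K > 0"
  shows "\<exists>C>0. C \<le> K \<and> (\<forall>q. 0 < q \<and> q \<le> C \<longrightarrow> P (sqrt q))"
proof -
  obtain d where d: "d > 0" "\<And>s. 0 < s \<Longrightarrow> s < d \<Longrightarrow> P s"
    using assms(1) by (auto simp: eventually_at_right_field)
  \<comment> \<open>Halving d turns the non-strict bound on q into the strict bound
    \<open>sqrt q < d\<close>.\<close>
  define C where "C = min K ((d / 2)\<^sup>2)"
  have "P (sqrt q)" if "0 < q" "q \<le> C" for q
  proof (rule d(2))
    have "sqrt q \<le> d / 2"
      using that d(1) by (intro real_le_lsqrt) (auto simp: C_def)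
    then show "sqrt q < d" using d(1) by simp
  qed (use that in simp)
  then show ?thesis
    using d(1) assms(2) by (intro exI[of _ C]) (auto simp: C_def)
qed

text \<open>Since \<mu> / L is at most 1, the range \<open>q \<le> C * \<mu> / L\<close> lies inside
  \<open>q \<le> C\<close>; a property of s alone therefore gets a constant independent of \<mu> and
  L.\<close>

lemma eventually_at_right_0_imp_sqrt_ratio:
  fixes P :: "real \<Rightarrow> bool"
  assumes "\<forall>\<^sub>F s in at_right 0. P s"
  shows "\<exists>C>0. \<forall>\<mu> L q. 0 < \<mu> \<and> \<mu> \<le> L \<and> 0 < q \<and> q \<le> C * \<mu> / L \<longrightarrow> P (sqrt q)"
proof -
  obtain C where C: "C > 0" "\<And>q. 0 < q \<Longrightarrow> q \<le> C \<Longrightarrow> P (sqrt q)"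
    using eventually_at_right_0_imp_sqrt[OF assms zero_less_one] by blast
  have "P (sqrt q)" if "0 < \<mu>" "\<mu> \<le> L" "0 < q" "q \<le> C * \<mu> / L" for \<mu> L q
  proof -
    have "C * \<mu> / L \<le> C"
      using that C(1) by (simp add: field_simps)
    with that C(2) show ?thesis by force
  qed
  with C(1) show ?thesis by blast
qed

text \<open>The sum tends to x as K decreases to 0, whatever the sign of y. This supplies the K that
  keeps a leading coefficient negative.\<close>

lemma exists_pos_add_mult_neg:
  fixes x y :: real
  assumes "x < 0"
  shows "\<exists>K>0. x + K * y < 0"
proof -
  have "((\<lambda>K. x + K * y) \<longlongrightarrow> x + 0 * y) (at_right 0)"
    by (intro tendsto_intros)
  then have "\<forall>\<^sub>F K in at_right 0. x + K * y < 0"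
    using assms by (intro order_tendstoD(2)) auto
  then obtain d where "d > 0" and d: "\<And>K. 0 < K \<Longrightarrow> K < d \<Longrightarrow> x + K * y < 0"
    by (auto simp: eventually_at_right_field)
  then show ?thesis
    using d[of "d / 2"] by (intro exI[of _ "d / 2"]) simp
qed

section \<open>Power series of I and II\<close>

lemma I_fun_has_fps_expansion:
  assumes "\<eta> has_fps_expansion E" "\<nu> has_fps_expansion V" "\<tau> has_fps_expansion T"
  shows "\<exists>F. I_fun \<eta> \<nu> \<tau> has_fps_expansion F"
  unfolding I_fun_def[abs_def] zeta_fun_def power2_eq_square
  \<comment> \<open>The witness stays schematic and is assembled from E, V and T by the expansion
    rules.\<close>
  by (rule exI, (rule fps_expansion_intros assms)+)

lemma II_fun_has_fps_expansion:
  assumes "\<eta> has_fps_expansion E" "\<nu> has_fps_expansion V" "\<tau> has_fps_expansion T"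
  shows "\<exists>F. II_fun \<eta> \<nu> \<tau> has_fps_expansion F"
  unfolding II_fun_def[abs_def] zeta_fun_def
  by (rule exI, (rule fps_expansion_intros assms)+)

theorem lemmaS1:
  fixes \<eta> \<nu> \<tau> I II :: "real \<Rightarrow> real"
    and a b :: "nat \<Rightarrow> real"
    and N M :: nat
  assumes "\<forall>\<^sub>F s in nhds 0. real_analytic_at \<eta> s"
    and "\<forall>\<^sub>F s in nhds 0. real_analytic_at \<nu> s"
    and "\<forall>\<^sub>F s in nhds 0. real_analytic_at \<tau> s"
    and "\<forall>\<^sub>F s in nhds 0. 0 \<le> s \<longrightarrow> 0 \<le> \<eta> s"
    and "\<forall>\<^sub>F s in nhds 0. 0 \<le> s \<longrightarrow> 0 \<le> \<nu> s"
    and "\<forall>\<^sub>F s in nhds 0. 0 \<le> s \<longrightarrow> 0 \<le> \<tau> s"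
  defines "I \<equiv> I_fun \<eta> \<nu> \<tau>"
    and "II \<equiv> II_fun \<eta> \<nu> \<tau>"
  defines "a \<equiv> taylor_coeff I"
    and "b \<equiv> taylor_coeff II"
  defines "N \<equiv> first_nonzero a"
    and "M \<equiv> first_nonzero b"
  shows "((\<exists>n. a n \<noteq> 0) \<and> (\<exists>m. b m \<noteq> 0) \<and> a N > 0 \<and> b M < 0 \<and> M + 2 \<le> N \<longrightarrow>
           (\<exists>C\<^sub>0>0. \<forall>\<mu> L q. 0 < \<mu> \<and> \<mu> \<le> L \<and> 0 < q \<and> q \<le> C\<^sub>0 * \<mu> / L \<longrightarrow>
              I (sqrt q) > 0 \<and> I (sqrt q) + sqrt q * II (sqrt q) \<le> 0)) \<and>
         ((\<exists>n. a n \<noteq> 0) \<and> (\<exists>m. b m \<noteq> 0) \<and> a N > 0 \<and> b M < 0 \<and> M + 1 = N \<and>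
           ((\<exists>n\<ge>N. a n + b (n - 1) < 0 \<and> (\<forall>k. N \<le> k \<and> k < n \<longrightarrow> a k + b (k - 1) = 0)) \<or>
            (\<forall>n\<ge>N. a n + b (n - 1) = 0)) \<longrightarrow>
           (\<exists>C\<^sub>0>0. \<forall>\<mu> L q. 0 < \<mu> \<and> \<mu> \<le> L \<and> 0 < q \<and> q \<le> C\<^sub>0 * \<mu> / L \<longrightarrow>
              I (sqrt q) > 0 \<and> I (sqrt q) + sqrt q * II (sqrt q) \<le> 0)) \<and>
         ((\<exists>n. a n \<noteq> 0) \<and> (\<exists>m. b m \<noteq> 0) \<and> a N < 0 \<and> b M > 0 \<and> M = N \<longrightarrow>
           (\<exists>C\<^sub>0>0. \<forall>\<mu> L q. 0 < \<mu> \<and> \<mu> \<le> L \<and> 0 < q \<and> q \<le> C\<^sub>0 * \<mu>\<^sup>2 / L\<^sup>2 \<longrightarrow>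
              II (sqrt q) > 0 \<and> \<mu> / L * I (sqrt q) + sqrt q * II (sqrt q) \<le> 0)) \<and>
         ((\<exists>n. a n \<noteq> 0) \<and> (\<exists>m. b m \<noteq> 0) \<and> a N < 0 \<and> b M > 0 \<and> M \<ge> N + 1 \<longrightarrow>
           (\<exists>C\<^sub>0>0. \<forall>\<mu> L q. 0 < \<mu> \<and> \<mu> \<le> L \<and> 0 < q \<and> q \<le> C\<^sub>0 * \<mu> / L \<longrightarrow>
              II (sqrt q) > 0 \<and> \<mu> / L * I (sqrt q) + sqrt q * II (sqrt q) \<le> 0)) \<and>
         (((\<nexists>n. a n \<noteq> 0) \<or> a N < 0) \<and> ((\<nexists>m. b m \<noteq> 0) \<or> b M < 0) \<longrightarrow>
           (\<exists>C\<^sub>0>0. \<forall>\<mu> L q. 0 < \<mu> \<and> \<mu> \<le> L \<and> 0 < q \<and> q \<le> C\<^sub>0 * \<mu> / L \<longrightarrow>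
              I (sqrt q) \<le> 0 \<and> II (sqrt q) \<le> 0))"
proof -
  \<comment> \<open>Analyticity near 0 is evaluated at the point 0, where the shifted function in
    \<open>real_analytic_at\<close> is the function itself.\<close>
  obtain A B where A: "I has_fps_expansion A" and B: "II has_fps_expansion B"
    using assms(1-3)[THEN eventually_nhds_x_imp_x] I_fun_has_fps_expansion II_fun_has_fps_expansion
    unfolding real_analytic_at_def I_def II_def by (metis (no_types, lifting) add_0 ext)
  have a: "a = fps_nth A" and b: "b = fps_nth B"
    using A B by (auto simp: a_def b_def taylor_coeff_eq_fps_nth)
  \<comment> \<open>This holds even if all coefficients vanish and the \<open>LEAST\<close> in N is
    unspecified; a sign condition on \<open>a N\<close> later rules that case out.\<close>
  have A0: "fps_nth A k = 0" if "k < N" for k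
    using that not_less_Least[of k "\<lambda>n. a n \<noteq> 0"] by (auto simp: N_def first_nonzero_def a)
  have B0: "fps_nth B k = 0" if "k < M" for k
    using that not_less_Least[of k "\<lambda>n. b n \<noteq> 0"] by (auto simp: M_def first_nonzero_def b)
  note I_pos = has_fps_expansion_imp_eventually_pos[where n=N, OF A A0]
  note I_neg = has_fps_expansion_imp_eventually_neg[where n=N, OF A A0]
  note II_pos = has_fps_expansion_imp_eventually_pos[where n=M, OF B B0]
  note II_neg = has_fps_expansion_imp_eventually_neg[where n=M, OF B B0]

  \<comment> \<open>I positive, II negative\<close>
  have S: "(\<lambda>s. I s + s * II s) has_fps_expansion A + fps_X * B"
    by (intro fps_expansion_intros A B)
  have ia: "\<exists>C\<^sub>0>0. \<forall>\<mu> L q. 0 < \<mu> \<and> \<mu> \<le> L \<and> 0 < q \<and> q \<le> C\<^sub>0 * \<mu> / L \<longrightarrow>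
      I (sqrt q) > 0 \<and> I (sqrt q) + sqrt q * II (sqrt q) \<le> 0"
    if "a N > 0" "b M < 0" "M + 2 \<le> N"
  proof -
    have "\<forall>\<^sub>F s in at_right 0. I s + s * II s < 0"
      \<comment> \<open>Multiplication by s moves \<open>b M\<close> to exponent M + 1, still below
        N, so it is the leading coefficient of the sum.\<close>
      by (rule has_fps_expansion_imp_eventually_neg[OF S, of "Suc M"])
        (use that A0 B0 in \<open>auto simp: b\<close>)
    moreover have "\<forall>\<^sub>F s in at_right 0. I s > 0"
      using that by (intro I_pos) (simp_all add: a)
    ultimately have "\<forall>\<^sub>F s in at_right 0. I s > 0 \<and> I s + s * II s \<le> 0"
      by eventually_elim auto
    then show ?thesis by (rule eventually_at_right_0_imp_sqrt_ratio)
  qed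
  have ib: "\<exists>C\<^sub>0>0. \<forall>\<mu> L q. 0 < \<mu> \<and> \<mu> \<le> L \<and> 0 < q \<and> q \<le> C\<^sub>0 * \<mu> / L \<longrightarrow>
      I (sqrt q) > 0 \<and> I (sqrt q) + sqrt q * II (sqrt q) \<le> 0"
    if "a N > 0" "M + 1 = N"
      and seq: "(\<exists>n\<ge>N. a n + b (n - 1) < 0 \<and> (\<forall>k. N \<le> k \<and> k < n \<longrightarrow> a k + b (k - 1) = 0)) \<or>
            (\<forall>n\<ge>N. a n + b (n - 1) = 0)"
  proof -
    \<comment> \<open>N = M + 1 is at least 1, so \<open>k - 1\<close> is genuine subtraction in the
      second branch. In the first, either k = 0 or k - 1 < M.\<close>
    have S_nth: "fps_nth (A + fps_X * B) k = (if k < N then 0 else a k + b (k - 1))" for k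
      using that(2) A0 B0 by (auto simp: a b)
    from seq have "\<forall>\<^sub>F s in at_right 0. I s + s * II s \<le> 0"
    proof
      assume "\<exists>n\<ge>N. a n + b (n - 1) < 0 \<and> (\<forall>k. N \<le> k \<and> k < n \<longrightarrow> a k + b (k - 1) = 0)"
      then obtain n where n: "n \<ge> N" "a n + b (n - 1) < 0"
        "\<And>k. N \<le> k \<Longrightarrow> k < n \<Longrightarrow> a k + b (k - 1) = 0" by blast
      have "\<forall>\<^sub>F s in at_right 0. I s + s * II s < 0"
        by (rule has_fps_expansion_imp_eventually_neg[OF S, of n], unfold S_nth) (use n in auto)
      then show ?thesis by eventually_elim simp
    next
      assume "\<forall>n\<ge>N. a n + b (n - 1) = 0"
      \<comment> \<open>Here I + s II vanishes identically near 0, the borderline case of the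
        non-strict inequality.\<close>
      then have "A + fps_X * B = 0"
        unfolding fps_eq_iff S_nth by simp
      with S have "\<forall>\<^sub>F s in at_right 0. I s + s * II s = 0"
        by (intro has_fps_expansion_0_imp_eventually_0) simp
      then show ?thesis by eventually_elim simp
    qed
    moreover have "\<forall>\<^sub>F s in at_right 0. I s > 0"
      using that by (intro I_pos) (simp_all add: a)
    ultimately have "\<forall>\<^sub>F s in at_right 0. I s > 0 \<and> I s + s * II s \<le> 0"
      by eventually_elim auto
    then show ?thesis by (rule eventually_at_right_0_imp_sqrt_ratio)
  qed

  \<comment> \<open>I negative, II positive, with the weight \<mu> / L\<close>
  have iia: "\<exists>C\<^sub>0>0. \<forall>\<mu> L q. 0 < \<mu> \<and> \<mu> \<le> L \<and> 0 < q \<and> q \<le> C\<^sub>0 * \<mu>\<^sup>2 / L\<^sup>2 \<longrightarrow>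
      II (sqrt q) > 0 \<and> \<mu> / L * I (sqrt q) + sqrt q * II (sqrt q) \<le> 0"
    if "a N < 0" "b M > 0" "M = N"
  proof -
    \<comment> \<open>As M = N, both series start at exponent N, and this is the coefficient of I +
      K II there.\<close>
    obtain K where K: "K > 0" "a N + K * b N < 0"
      using exists_pos_add_mult_neg[OF \<open>a N < 0\<close>] by blast
    have "(\<lambda>s. I s + K * II s) has_fps_expansion A + fps_const K * B"
      by (intro fps_expansion_intros A B)
    then have "\<forall>\<^sub>F s in at_right 0. I s + K * II s < 0"
      by (rule has_fps_expansion_imp_eventually_neg[of _ _ N])
        (use K that A0 B0 in \<open>auto simp: a b\<close>)
    moreover have "\<forall>\<^sub>F s in at_right 0. II s > 0"
      using that by (intro II_pos) (simp_all add: b)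
    ultimately have "\<forall>\<^sub>F s in at_right 0. II s > 0 \<and> I s + K * II s < 0"
      by eventually_elim auto
    \<comment> \<open>The cap \<open>K^2\<close> turns the bound on q into
      \<open>sqrt q \<le> K * r\<close> with r = \<mu> / L.\<close>
    from eventually_at_right_0_imp_sqrt[OF this, of "K\<^sup>2"] K(1)
    obtain C where C: "C > 0" "C \<le> K\<^sup>2"
      "\<And>q. 0 < q \<Longrightarrow> q \<le> C \<Longrightarrow> II (sqrt q) > 0 \<and> I (sqrt q) + K * II (sqrt q) < 0"
      by auto
    have "II (sqrt q) > 0 \<and> \<mu> / L * I (sqrt q) + sqrt q * II (sqrt q) \<le> 0"
      if h: "0 < \<mu>" "\<mu> \<le> L" "0 < q" "q \<le> C * \<mu>\<^sup>2 / L\<^sup>2" for \<mu> L q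
    proof -
      define r where "r = \<mu> / L"
      have r: "0 < r" "r \<le> 1" and q: "q \<le> C * r\<^sup>2"
        using h by (auto simp: r_def power_divide)
      have "C * r\<^sup>2 \<le> C"
        using C(1) r by (simp add: power_le_one mult_left_le)
      with C(3) h(3) q have II: "II (sqrt q) > 0" and sum: "I (sqrt q) + K * II (sqrt q) < 0"
        by force+
      have "q \<le> (K * r)\<^sup>2"
        using q mult_right_mono[OF C(2), of "r\<^sup>2"] by (simp add: power_mult_distrib)
      then have "sqrt q \<le> K * r"
        using K(1) r(1) by (intro real_le_lsqrt) auto
      then have "r * I (sqrt q) + sqrt q * II (sqrt q) \<le> r * (I (sqrt q) + K * II (sqrt q))"
        using mult_right_mono[of "sqrt q" "K * r" "II (sqrt q)"] II by (simp add: algebra_simps)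
      also have "\<dots> \<le> 0"
        using r(1) sum by (simp add: mult_le_0_iff)
      finally show ?thesis using II by (simp add: r_def)
    qed
    with C(1) show ?thesis by blast
  qed
  have iib: "\<exists>C\<^sub>0>0. \<forall>\<mu> L q. 0 < \<mu> \<and> \<mu> \<le> L \<and> 0 < q \<and> q \<le> C\<^sub>0 * \<mu> / L \<longrightarrow>
      II (sqrt q) > 0 \<and> \<mu> / L * I (sqrt q) + sqrt q * II (sqrt q) \<le> 0"
    if "a N < 0" "b M > 0" "M \<ge> N + 1"
  proof -
    \<comment> \<open>The factor s moves \<open>a N\<close> to exponent N + 1, which is at most M.
      The term \<open>b (Suc N)\<close> is \<open>b M\<close> if M = N + 1 and 0 otherwise; one
      choice of K covers both.\<close>
    obtain K where K: "K > 0" "a N + K * b (Suc N) < 0"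
      using exists_pos_add_mult_neg[OF \<open>a N < 0\<close>] by blast
    have "(\<lambda>s. s * I s + K * II s) has_fps_expansion fps_X * A + fps_const K * B"
      by (intro fps_expansion_intros A B)
    then have "\<forall>\<^sub>F s in at_right 0. s * I s + K * II s < 0"
      by (rule has_fps_expansion_imp_eventually_neg[of _ _ "Suc N"])
        (use K that A0 B0 in \<open>auto simp: a b\<close>)
    moreover have "\<forall>\<^sub>F s in at_right 0. II s > 0"
      using that by (intro II_pos) (simp_all add: b)
    ultimately have "\<forall>\<^sub>F s in at_right 0. II s > 0 \<and> s * I s + K * II s < 0"
      by eventually_elim auto
    \<comment> \<open>The cap K gives \<open>q \<le> K * r\<close>: a bound on s squared, so the
      power of \<mu> / L is only the first.\<close>
    from eventually_at_right_0_imp_sqrt[OF this, of K] K(1)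
    obtain C where C: "C > 0" "C \<le> K"
      "\<And>q. 0 < q \<Longrightarrow> q \<le> C \<Longrightarrow> II (sqrt q) > 0 \<and> sqrt q * I (sqrt q) + K * II (sqrt q) < 0"
      by auto
    have "II (sqrt q) > 0 \<and> \<mu> / L * I (sqrt q) + sqrt q * II (sqrt q) \<le> 0"
      if h: "0 < \<mu>" "\<mu> \<le> L" "0 < q" "q \<le> C * \<mu> / L" for \<mu> L q
    proof -
      define r where "r = \<mu> / L"
      define s where "s = sqrt q"
      have r: "0 < r" "r \<le> 1" and q: "q \<le> C * r"
        using h by (auto simp: r_def)
      have s: "s > 0" "s * s = q"
        using h(3) by (auto simp: s_def)
      have "C * r \<le> C"
        using C(1) r by (simp add: mult_left_le)
      with C(3) h(3) q have II: "II s > 0" and sum: "s * I s + K * II s < 0"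
        unfolding s_def by force+
      have "q \<le> K * r"
        using q mult_right_mono[OF C(2), of r] r(1) by linarith
      \<comment> \<open>The extra factor s produces \<open>s * s = q\<close> in front of II, where
        the bound on q and II > 0 apply; s > 0 is cancelled at the end.\<close>
      then have "s * (r * I s + s * II s) \<le> r * (s * I s + K * II s)"
        using mult_right_mono[of q "K * r" "II s"] II
        by (simp add: algebra_simps flip: s(2))
      also have "\<dots> \<le> 0"
        using r(1) sum by (simp add: mult_le_0_iff)
      finally show ?thesis using II s(1) by (simp add: r_def s_def mult_le_0_iff)
    qed
    with C(1) show ?thesis by blast
  qed

  \<comment> \<open>Both I and II non-positive\<close>
  have iii: "\<exists>C\<^sub>0>0. \<forall>\<mu> L q. 0 < \<mu> \<and> \<mu> \<le> L \<and> 0 < q \<and> q \<le> C\<^sub>0 * \<mu> / L \<longrightarrow>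
      I (sqrt q) \<le> 0 \<and> II (sqrt q) \<le> 0"
    if "(\<nexists>n. a n \<noteq> 0) \<or> a N < 0" "(\<nexists>m. b m \<noteq> 0) \<or> b M < 0"
  proof -
    have "\<forall>\<^sub>F s in at_right 0. I s \<le> 0"
      using that(1)
    proof
      assume "\<nexists>n. a n \<noteq> 0"
      \<comment> \<open>With no leading coefficient to give a sign, the zero series makes I vanish
        near 0.\<close>
      then have "A = 0" by (simp add: a fps_eq_iff)
      with A have "\<forall>\<^sub>F s in at_right 0. I s = 0"
        by (intro has_fps_expansion_0_imp_eventually_0) simp
      then show ?thesis by eventually_elim simp
    next
      assume "a N < 0"
      then have "\<forall>\<^sub>F s in at_right 0. I s < 0"
        by (intro I_neg) (simp_all add: a)
      then show ?thesis by eventually_elim simp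
    qed
    moreover have "\<forall>\<^sub>F s in at_right 0. II s \<le> 0"
      using that(2)
    proof
      assume "\<nexists>m. b m \<noteq> 0"
      then have "B = 0" by (simp add: b fps_eq_iff)
      with B have "\<forall>\<^sub>F s in at_right 0. II s = 0"
        by (intro has_fps_expansion_0_imp_eventually_0) simp
      then show ?thesis by eventually_elim simp
    next
      assume "b M < 0"
      then have "\<forall>\<^sub>F s in at_right 0. II s < 0"
        by (intro II_neg) (simp_all add: b)
      then show ?thesis by eventually_elim simp
    qed
    ultimately have "\<forall>\<^sub>F s in at_right 0. I s \<le> 0 \<and> II s \<le> 0"
      by eventually_elim auto
    then show ?thesis by (rule eventually_at_right_0_imp_sqrt_ratio)
  qed
  from ia ib iia iib iii show ?thesis by (intro conjI impI) (elim conjE; blast)+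
qed

end
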